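(* Let $(X,\widehat d_X)$ be a compact non-Archimedean metric space, and let $K$ be a complete non-Archimedean valued field with absolute value $|\cdot|$, such that every ball in $X$ and every ball in $K$ contains at least two distinct points. Let $\mu\in\mathrm{MEA}(X\to K)$ and let $\{\mu_n\}_{n=1}^\infty$ be a sequence in $\mathrm{MEA}(X\to K)$. If there exists $c>0$ such that $\|\mu_n\|\le c$ for all positive integers $n$, then the following statements are equivalent: (1) $\mu_n\to\mu$; (2) $\int_X f\,d\mu_n\to\int_X f\,d\mu$ for all $f\in\widehat{BL}(X\to K)$; (3) $\widehat D_{X,K}(\mu_n,\mu)\to0$.
   Context: A non-Archimedean metric satisfies $\widehat d(x,z)\le\max\{\widehat d(x,y),\widehat d(y,z)\}$. A ball in a non-Archimedean metric space is a set $\{x:\widehat d(a,x)<r\}$ or $\{x:\widehat d(a,x)\le r\}$ with $0<r<\infty$ ($K$ carries the metric $|\alpha-\beta|$). $\mathfrak C(X\to K)$ is the $K$-vector space of continuous functions $X\to K$ with the supremum norm $\|f\|_\infty=\sup_{x\in X}|f(x)|$. A $K$-valued measure on $X$ is a $K$-linear functional $\mu:\mathfrak C(X\to K)\to K$ for which there is $M\ge0$ with $|\mu(f)|\le M\|f\|_\infty$ for all $f$; one writes $\int_X f\,d\mu=\mu(f)$, and $\|\mu\|$ denotes the least such $M$. $\mathrm{MEA}(X\to K)$ is the set of all $K$-valued measures on $X$. $\mu_n\to\mu$ means $\int_X f\,d\mu_n\to\int_X f\,d\mu$ as $n\to\infty$ for every $f\in\mathfrak C(X\to K)$. For $f:X\to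 K$, $\operatorname{dil}(f)=\sup_{x_1\ne x_2}\frac{|f(x_1)-f(x_2)|}{\widehat d_X(x_1,x_2)}$, $\|f\|_{\widehat{BL}}=\max\{\|f\|_\infty,\operatorname{dil}(f)\}\in[0,\infty]$, and $\widehat{BL}(X\to K)$ is the set of all $f:X\to K$ with $\|f\|_{\widehat{BL}}<\infty$. For $\mu_1,\mu_2\in\mathrm{MEA}(X\to K)$, $$\widehat D_{X,K}(\mu_1,\mu_2)=\sup\Big\{\Big|\int_X f\,d\mu_1-\int_X f\,d\mu_2\Big|:\ f\in\mathfrak C(X\to K),\ \|f\|_{\widehat{BL}}\le1\Big\}.$$ *)

theory Defs
  imports "HOL-Analysis.Analysis"
begin

text \<open>
  A field with a non-Archimedean absolute value, carrying the induced metric. Nonnegativity and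
  definiteness follow from \<open>absval x = dist x 0\<close>. The library constant \<^const>\<open>norm\<close> is
  constrained to real normed vector spaces, which these fields are not, so a new one is introduced.
\<close>

class nonarch_valued_field = field + metric_space +
  fixes absval :: "'a \<Rightarrow> real"
  assumes dist_absval: "dist x y = absval (x - y)"
    and absval_mult: "absval (x * y) = absval x * absval y"
    and absval_add_le_max: "absval (x + y) \<le> max (absval x) (absval y)"

definition is_ball :: "'a::metric_space set \<Rightarrow> bool" where
  "is_ball B \<longleftrightarrow> (\<exists>a r. 0 < r \<and> (B = ball a r \<or> B = cball a r))"

definition Cont :: "('a::topological_space \<Rightarrow> 'k::topological_space) set" where
  "Cont = {f. continuous_on UNIV f}"

definition sup_norm :: "('a \<Rightarrow> 'k::nonarch_valued_field) \<Rightarrow> ennreal" where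
  "sup_norm f = (SUP x. ennreal (absval (f x)))"

definition dil :: "('a::metric_space \<Rightarrow> 'k::nonarch_valued_field) \<Rightarrow> ennreal" where
  "dil f = (SUP (x, y) \<in> {(x, y). x \<noteq> y}. ennreal (absval (f x - f y) / dist x y))"

definition BL_norm :: "('a::metric_space \<Rightarrow> 'k::nonarch_valued_field) \<Rightarrow> ennreal" where
  "BL_norm f = max (sup_norm f) (dil f)"

definition BL :: "('a::metric_space \<Rightarrow> 'k::nonarch_valued_field) set" where
  "BL = {f. BL_norm f < \<infinity>}"

definition measure_bound ::
    "(('a::topological_space \<Rightarrow> 'k::nonarch_valued_field) \<Rightarrow> 'k) \<Rightarrow> real \<Rightarrow> bool" where
  "measure_bound \<mu> M \<longleftrightarrow>
     0 \<le> M \<and> (\<forall>f\<in>Cont. ennreal (absval (\<mu> f)) \<le> ennreal M * sup_norm f)"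

text \<open>
  A measure is a functional on \<^const>\<open>Cont\<close>. It is represented by a total HOL function, whose values
  outside \<^const>\<open>Cont\<close> are irrelevant. The integral of \<open>f\<close> with respect to \<open>\<mu>\<close> is \<open>\<mu> f\<close>.
\<close>

definition MEA :: "(('a::topological_space \<Rightarrow> 'k::nonarch_valued_field) \<Rightarrow> 'k) set" where
  "MEA = {\<mu>. (\<forall>f\<in>Cont. \<forall>g\<in>Cont. \<mu> (\<lambda>x. f x + g x) = \<mu> f + \<mu> g) \<and>
              (\<forall>a. \<forall>f\<in>Cont. \<mu> (\<lambda>x. a * f x) = a * \<mu> f) \<and>
              (\<exists>M. measure_bound \<mu> M)}"

text \<open>For compact domains, the least bound of a measure is attained, so \<open>LEAST\<close> is meaningful on \<open>MEA\<close>.\<close>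

definition mea_norm :: "(('a::topological_space \<Rightarrow> 'k::nonarch_valued_field) \<Rightarrow> 'k) \<Rightarrow> real" where
  "mea_norm \<mu> = (LEAST M. measure_bound \<mu> M)"

definition mea_converges ::
    "(nat \<Rightarrow> ('a::topological_space \<Rightarrow> 'k::nonarch_valued_field) \<Rightarrow> 'k)
       \<Rightarrow> (('a \<Rightarrow> 'k) \<Rightarrow> 'k) \<Rightarrow> bool" where
  "mea_converges \<mu>s \<mu> \<longleftrightarrow> (\<forall>f\<in>Cont. (\<lambda>n. \<mu>s n f) \<longlonglongrightarrow> \<mu> f)"

definition BL_dist :: "(('a::metric_space \<Rightarrow> 'k::nonarch_valued_field) \<Rightarrow> 'k)
    \<Rightarrow> (('a \<Rightarrow> 'k) \<Rightarrow> 'k) \<Rightarrow> ennreal" where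
  "BL_dist \<mu> \<nu> = (SUP f \<in> {f \<in> Cont. BL_norm f \<le> 1}. ennreal (absval (\<mu> f - \<nu> f)))"

end

theory Submission
  imports Defs
begin

text \<open>
  A compact ultrametric space is, for every \<open>\<epsilon> > 0\<close>, the disjoint union of finitely many balls
  of radius \<open>\<epsilon>\<close>, which are open. Choosing a centre in each of these cells gives a retraction
  \<open>c\<close> of the space onto a finite set (\<open>finite_ultrametric_retraction\<close>), and \<open>f \<circ> c\<close> is
  a finite linear combination of the indicators of the cells. These indicators are Lipschitz, because
  distinct cells are at distance at least \<open>\<epsilon>\<close>.

  If \<open>f\<close> varies by at most \<open>\<delta>\<close> on each cell, then two measures \<open>\<mu>\<close> and \<open>\<nu>\<close> with bounds
  \<open>M\<close> and \<open>N\<close> satisfy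
  \[ |\mu(f) - \nu(f)| \le (M + N)\delta + \sum_s |f(s)| |\mu(1_s) - \nu(1_s)|, \]
  where \<open>s\<close> runs through the centres and \<open>1_s\<close> is the indicator of the cell of \<open>s\<close>
  (\<open>measure_diff_le_cells\<close>). This one estimate gives both implications that start from
  convergence on \<^const>\<open>BL\<close>, since the norms of the measures are uniformly bounded and the sum
  tends to \<open>0\<close>. For a single continuous \<open>f\<close>, uniform continuity supplies the cells. For all
  \<open>f\<close> with \<open>BL_norm f \<le> 1\<close> at once, the choice \<open>\<delta> = \<epsilon>\<close> works, and \<open>|f(s)| \<le> 1\<close> removes
  the dependence of the sum on \<open>f\<close>. This replaces an Arzela--Ascoli argument, which fails
  when \<open>K\<close> is not locally compact: the unit ball of \<^const>\<open>BL\<close> is then not totally bounded in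
  the supremum norm.

  Conversely, convergence on \<^const>\<open>Cont\<close> restricts to \<^const>\<open>BL\<close>, whose members are Lipschitz.
  Finally, since \<open>K\<close> has nonzero elements of arbitrarily small absolute value, each \<open>f\<close> in
  \<^const>\<open>BL\<close> has a nonzero scalar multiple \<open>a f\<close> in the unit ball, so that
  \<open>|a| |\<mu>\<^sub>n(f) - \<mu>(f)|\<close> is bounded by the distance of \<open>\<mu>\<^sub>n\<close> and \<open>\<mu>\<close>.
\<close>

section \<open>Non-Archimedean absolute values\<close>

lemma absval_eq_dist: "absval x = dist x (0::'k::nonarch_valued_field)"
  by (simp add: dist_absval)

lemma absval_nonneg [simp]: "0 \<le> absval (x::'k::nonarch_valued_field)"
  by (simp add: absval_eq_dist)

lemma absval_eq_0_iff [simp]: "absval x = 0 \<longleftrightarrow> x = (0::'k::nonarch_valued_field)"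
  by (simp add: absval_eq_dist)

lemma absval_0 [simp]: "absval (0::'k::nonarch_valued_field) = 0"
  by simp

lemma absval_1 [simp]: "absval (1::'k::nonarch_valued_field) = 1"
  using absval_mult[of "1::'k" 1] by simp

lemma absval_minus_commute: "absval (x - y) = absval (y - (x::'k::nonarch_valued_field))"
  by (metis dist_absval dist_commute)

lemma absval_minus [simp]: "absval (- x) = absval (x::'k::nonarch_valued_field)"
  using absval_minus_commute[of 0 x] by simp

lemma absval_add_le: "absval (x + y) \<le> absval x + absval (y::'k::nonarch_valued_field)"
  using absval_add_le_max[of x y] absval_nonneg[of x] absval_nonneg[of y] by linarith

lemma absval_diff_le: "absval (x - y) \<le> absval x + absval (y::'k::nonarch_valued_field)"
  using absval_add_le[of x "- y"] by simp

lemma absval_sum_le: "absval (sum f A) \<le> (\<Sum>i\<in>A. absval (f i :: 'k::nonarch_valued_field))"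
proof (induction A rule: infinite_finite_induct)
  case (insert x F)
  then show ?case using absval_add_le[of "f x" "sum f F"] by simp
qed simp_all

lemma tendsto_iff_absval:
  fixes f :: "'b \<Rightarrow> 'k::nonarch_valued_field"
  shows "(f \<longlongrightarrow> l) F \<longleftrightarrow> ((\<lambda>x. absval (f x - l)) \<longlongrightarrow> 0) F"
  using tendsto_dist_iff[of f l F] by (simp add: dist_absval)

lemma Cont_iff:
  fixes f :: "'a::metric_space \<Rightarrow> 'k::nonarch_valued_field"
  shows "f \<in> Cont \<longleftrightarrow> (\<forall>x. \<forall>e>0. \<exists>d>0. \<forall>y. dist y x < d \<longrightarrow> absval (f y - f x) < e)"
  by (simp add: Cont_def continuous_on_iff dist_absval)

lemma Cont_add:
  fixes f g :: "'a::metric_space \<Rightarrow> 'k::nonarch_valued_field"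
  assumes "f \<in> Cont" "g \<in> Cont"
  shows "(\<lambda>x. f x + g x) \<in> Cont"
  unfolding Cont_iff
proof (intro allI impI)
  fix x and e :: real assume "e > 0"
  obtain d1 where d1: "d1 > 0" "\<And>y. dist y x < d1 \<Longrightarrow> absval (f y - f x) < e"
    using assms(1) \<open>e > 0\<close> unfolding Cont_iff by blast
  obtain d2 where d2: "d2 > 0" "\<And>y. dist y x < d2 \<Longrightarrow> absval (g y - g x) < e"
    using assms(2) \<open>e > 0\<close> unfolding Cont_iff by blast
  have "absval (f y + g y - (f x + g x)) < e" if "dist y x < min d1 d2" for y
  proof -
    have eq: "f y + g y - (f x + g x) = (f y - f x) + (g y - g x)" by simp
    show ?thesis unfolding eq
      using d1(2)[of y] d2(2)[of y] that absval_add_le_max[of "f y - f x" "g y - g x"] by simp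
  qed
  then show "\<exists>d>0. \<forall>y. dist y x < d \<longrightarrow> absval (f y + g y - (f x + g x)) < e"
    using d1(1) d2(1) by (intro exI[of _ "min d1 d2"]) auto
qed

lemma Cont_scale:
  fixes f :: "'a::metric_space \<Rightarrow> 'k::nonarch_valued_field"
  assumes "f \<in> Cont"
  shows "(\<lambda>x. a * f x) \<in> Cont"
  unfolding Cont_iff
proof (intro allI impI)
  fix x and e :: real assume "e > 0"
  have pos: "absval a + 1 > 0" using absval_nonneg[of a] by linarith
  obtain d where d: "d > 0" "\<And>y. dist y x < d \<Longrightarrow> absval (f y - f x) < e / (absval a + 1)"
    using assms \<open>e > 0\<close> pos unfolding Cont_iff by (meson divide_pos_pos)
  have "absval (a * f y - a * f x) < e" if "dist y x < d" for y
  proof -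
    have "absval (a * f y - a * f x) = absval a * absval (f y - f x)"
      by (metis absval_mult right_diff_distrib)
    also have "\<dots> \<le> (absval a + 1) * absval (f y - f x)"
      by (simp add: mult_right_mono)
    also have "\<dots> < e" using d(2)[OF that] pos by (simp add: field_simps)
    finally show ?thesis .
  qed
  then show "\<exists>d>0. \<forall>y. dist y x < d \<longrightarrow> absval (a * f y - a * f x) < e"
    using d(1) by blast
qed

lemma Cont_if_locally_constant:
  fixes f :: "'a::metric_space \<Rightarrow> 'k::nonarch_valued_field"
  assumes "\<epsilon> > 0" "\<And>x y. dist x y < \<epsilon> \<Longrightarrow> f x = f y"
  shows "f \<in> Cont"
  unfolding Cont_iff using assms by (metis absval_0 diff_self)

section \<open>Bounded Lipschitz functions\<close>

lemma BL_norm_le_ennreal_iff: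
  fixes f :: "'a::metric_space \<Rightarrow> 'k::nonarch_valued_field"
  assumes "0 \<le> r"
  shows "BL_norm f \<le> ennreal r \<longleftrightarrow>
    (\<forall>x. absval (f x) \<le> r) \<and> (\<forall>x y. absval (f x - f y) \<le> r * dist x y)"
proof -
  have "absval (f x - f y) / dist x y \<le> r \<longleftrightarrow> absval (f x - f y) \<le> r * dist x y"
    if "x \<noteq> y" for x y using that by (simp add: divide_le_eq)
  then show ?thesis
    using assms
    by (auto simp: BL_norm_def sup_norm_def dil_def SUP_le_iff)
      (metis absval_0 diff_self dist_self mult_zero_right order_refl)
qed

lemma BL_iff:
  fixes f :: "'a::metric_space \<Rightarrow> 'k::nonarch_valued_field"
  shows "f \<in> BL \<longleftrightarrow> (\<exists>r\<ge>0. BL_norm f \<le> ennreal r)"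
proof
  assume "f \<in> BL"
  then show "\<exists>r\<ge>0. BL_norm f \<le> ennreal r"
    by (cases "BL_norm f") (auto simp: BL_def)
next
  assume "\<exists>r\<ge>0. BL_norm f \<le> ennreal r"
  then show "f \<in> BL" by (auto simp: BL_def intro: le_less_trans)
qed

lemma BL_subset_Cont: "BL \<subseteq> (Cont :: ('a::metric_space \<Rightarrow> 'k::nonarch_valued_field) set)"
proof
  fix f :: "'a \<Rightarrow> 'k" assume "f \<in> BL"
  then obtain r where r: "r \<ge> 0" "\<And>x y. absval (f x - f y) \<le> r * dist x y"
    by (auto simp: BL_iff BL_norm_le_ennreal_iff)
  show "f \<in> Cont" unfolding Cont_iff
  proof (intro allI impI)
    fix x and e :: real assume "e > 0"
    have "absval (f y - f x) < e" if "dist y x < e / (r + 1)" for y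
    proof -
      have "absval (f y - f x) \<le> (r + 1) * dist y x"
        using r(2)[of y x] by (simp add: algebra_simps add_increasing)
      also have "\<dots> < e" using that r(1) by (simp add: field_simps)
      finally show ?thesis .
    qed
    then show "\<exists>d>0. \<forall>y. dist y x < d \<longrightarrow> absval (f y - f x) < e"
      using \<open>e > 0\<close> r(1) by (intro exI[of _ "e / (r + 1)"]) auto
  qed
qed

text \<open>
  Two points with different values are at distance at least \<open>\<epsilon>\<close>, so twice the supremum divided
  by \<open>\<epsilon>\<close> is a Lipschitz constant.
\<close>

lemma BL_if_locally_constant:
  fixes f :: "'a::metric_space \<Rightarrow> 'k::nonarch_valued_field"
  assumes eps: "\<epsilon> > 0" and const: "\<And>x y. dist x y < \<epsilon> \<Longrightarrow> f x = f y"
    and bd: "\<And>x. absval (f x) \<le> B"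
  shows "f \<in> BL"
proof -
  have B: "0 \<le> B" using bd absval_nonneg order_trans by blast
  define r where "r = max B (2 * B / \<epsilon>)"
  have "r \<ge> 0" using B by (simp add: r_def)
  have "absval (f x - f y) \<le> r * dist x y" for x y
  proof (cases "dist x y < \<epsilon>")
    case True
    then show ?thesis using const[OF True] \<open>r \<ge> 0\<close> by simp
  next
    case False
    have "absval (f x - f y) \<le> 2 * B"
      using absval_diff_le[of "f x" "f y"] bd[of x] bd[of y] by linarith
    also have "\<dots> = 2 * B / \<epsilon> * \<epsilon>" using eps by simp
    also have "\<dots> \<le> r * dist x y"
      using False B eps by (intro mult_mono) (auto simp: r_def)
    finally show ?thesis .
  qed
  moreover have "absval (f x) \<le> r" for x using bd[of x] by (simp add: r_def)
  ultimately show ?thesis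
    using \<open>r \<ge> 0\<close> by (auto simp: BL_iff BL_norm_le_ennreal_iff)
qed

section \<open>Measures as bounded functionals\<close>

lemma measure_bound_absval_le:
  fixes f :: "'a::topological_space \<Rightarrow> 'k::nonarch_valued_field"
  assumes "measure_bound \<mu> M" "f \<in> Cont" "0 \<le> r" "\<And>x. absval (f x) \<le> r"
  shows "absval (\<mu> f) \<le> M * r"
proof -
  have "0 \<le> M" using assms(1) by (simp add: measure_bound_def)
  have "ennreal (absval (\<mu> f)) \<le> ennreal M * sup_norm f"
    using assms by (simp add: measure_bound_def)
  also have "\<dots> \<le> ennreal M * ennreal r"
    using assms(3,4) by (intro mult_left_mono) (auto simp: sup_norm_def SUP_le_iff)
  finally show ?thesis using \<open>0 \<le> M\<close> assms(3) by (simp flip: ennreal_mult)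
qed

lemma sup_norm_finite:
  fixes f :: "'a::topological_space \<Rightarrow> 'k::nonarch_valued_field"
  assumes "compact (UNIV :: 'a set)" "f \<in> Cont"
  obtains r where "0 \<le> r" "sup_norm f = ennreal r"
proof -
  have "bounded (range f)"
    using assms compact_continuous_image compact_imp_bounded unfolding Cont_def by blast
  then obtain B where B: "\<And>x. absval (f x) \<le> B"
    unfolding bounded_any_center[where a = 0] by (auto simp: absval_eq_dist dist_commute)
  then have "sup_norm f \<le> ennreal B"
    by (auto simp: sup_norm_def SUP_le_iff intro: ennreal_leI)
  then have "sup_norm f \<noteq> top" by (auto simp: top_unique)
  then show thesis using that by (cases "sup_norm f") auto
qed

text \<open>
  The bounds of a measure form a closed set of reals bounded below, so the infimum is itself a
  bound. Compactness is needed for the supremum norms to be finite, which turns the defining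
  inequalities into closed conditions on a real number.
\<close>

lemma measure_bound_mea_norm:
  fixes \<mu> :: "('a::topological_space \<Rightarrow> 'k::nonarch_valued_field) \<Rightarrow> 'k"
  assumes comp: "compact (UNIV :: 'a set)" and mu: "\<mu> \<in> MEA"
  shows "measure_bound \<mu> (mea_norm \<mu>)"
proof -
  define S where "S = {M. measure_bound \<mu> M}"
  have ne: "S \<noteq> {}" using mu by (auto simp: MEA_def S_def)
  have nonneg: "0 \<le> M" if "M \<in> S" for M using that by (simp add: S_def measure_bound_def)
  have bdd: "bdd_below S" using nonneg by (auto simp: bdd_below_def)
  have Inf0: "0 \<le> Inf S" using ne nonneg by (rule cInf_greatest)
  have "ennreal (absval (\<mu> f)) \<le> ennreal (Inf S) * sup_norm f" if f: "f \<in> Cont" for f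
  proof -
    obtain r where r: "0 \<le> r" "sup_norm f = ennreal r" using sup_norm_finite[OF comp f] by blast
    have le: "absval (\<mu> f) \<le> M * r" if "M \<in> S" for M
    proof -
      have "ennreal (absval (\<mu> f)) \<le> ennreal M * ennreal r"
        using that f r by (auto simp: S_def measure_bound_def)
      then show ?thesis using nonneg[OF that] r(1) by (simp flip: ennreal_mult)
    qed
    have "absval (\<mu> f) \<le> Inf S * r"
    proof (cases "r = 0")
      case True
      then show ?thesis using le ne by auto
    next
      case False
      then have "absval (\<mu> f) / r \<le> Inf S"
        using le r(1) by (intro cInf_greatest[OF ne]) (simp add: divide_le_eq)
      then show ?thesis using False r(1) by (simp add: divide_le_eq)
    qed
    then show ?thesis using r Inf0 by (simp flip: ennreal_mult)
  qed
  then have bound: "measure_bound \<mu> (Inf S)" using Inf0 by (simp add: measure_bound_def)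
  have "mea_norm \<mu> = Inf S" unfolding mea_norm_def
    using bound bdd by (intro Least_equality) (auto simp: S_def intro: cInf_lower)
  then show ?thesis using bound by simp
qed

lemma measure_bound_mono:
  assumes "measure_bound \<mu> M" "M \<le> N"
  shows "measure_bound \<mu> N"
  unfolding measure_bound_def
proof (intro conjI ballI)
  show "0 \<le> N" using assms by (simp add: measure_bound_def)
  fix f assume "f \<in> (Cont :: ('a \<Rightarrow> 'b) set)"
  then have "ennreal (absval (\<mu> f)) \<le> ennreal M * sup_norm f"
    using assms by (simp add: measure_bound_def)
  also have "\<dots> \<le> ennreal N * sup_norm f"
    using assms(2) by (intro mult_right_mono ennreal_leI) auto
  finally show "ennreal (absval (\<mu> f)) \<le> ennreal N * sup_norm f" .
qed

lemma MEA_add: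
  "\<mu> \<in> MEA \<Longrightarrow> f \<in> Cont \<Longrightarrow> g \<in> Cont \<Longrightarrow> \<mu> (\<lambda>x. f x + g x) = \<mu> f + \<mu> g"
  by (simp add: MEA_def)

lemma MEA_scale: "\<mu> \<in> MEA \<Longrightarrow> f \<in> Cont \<Longrightarrow> \<mu> (\<lambda>x. a * f x) = a * \<mu> f"
  by (simp add: MEA_def)

lemma MEA_linear_combination:
  fixes f :: "'i \<Rightarrow> 'a::metric_space \<Rightarrow> 'k::nonarch_valued_field"
  assumes mu: "\<mu> \<in> MEA" and "finite S" and f: "\<And>s. s \<in> S \<Longrightarrow> f s \<in> Cont"
  shows "(\<lambda>x. \<Sum>s\<in>S. a s * f s x) \<in> Cont \<and>
         \<mu> (\<lambda>x. \<Sum>s\<in>S. a s * f s x) = (\<Sum>s\<in>S. a s * \<mu> (f s))"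
  using \<open>finite S\<close> f
proof (induction S rule: finite_induct)
  case empty
  have "(\<lambda>x. 0) \<in> (Cont :: ('a \<Rightarrow> 'k) set)" by (auto intro: Cont_if_locally_constant[of 1])
  then show ?case using MEA_scale[OF mu, of "\<lambda>x. 0" 0] by simp
next
  case (insert s S)
  let ?g = "\<lambda>x. \<Sum>s\<in>S. a s * f s x"
  have IH: "?g \<in> Cont" "\<mu> ?g = (\<Sum>s\<in>S. a s * \<mu> (f s))"
    using insert.IH insert.prems by auto
  have fs: "f s \<in> Cont" using insert.prems by simp
  have "(\<lambda>x. a s * f s x + ?g x) \<in> Cont" using Cont_add[OF Cont_scale[OF fs] IH(1)] .
  moreover have "\<mu> (\<lambda>x. a s * f s x + ?g x) = a s * \<mu> (f s) + \<mu> ?g"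
    using MEA_add[OF mu Cont_scale[OF fs] IH(1)] MEA_scale[OF mu fs] by simp
  ultimately show ?case using insert.hyps IH(2) by simp
qed

section \<open>Partition into finitely many balls\<close>

text \<open>
  In an ultrametric space every point of a ball is a centre of it, so points at distance less than
  \<open>\<epsilon>\<close> have the same ball. A choice that depends on the ball alone is therefore constant on it,
  and finitely many balls cover the space.
\<close>

lemma finite_ultrametric_retraction:
  fixes \<epsilon> :: real
  assumes ultrametric: "\<And>x y z :: 'a::metric_space. dist x z \<le> max (dist x y) (dist y z)"
    and comp: "compact (UNIV :: 'a::metric_space set)" and eps: "\<epsilon> > 0"
  obtains c :: "'a::metric_space \<Rightarrow> 'a"
  where "finite (range c)" "\<And>x. dist x (c x) < \<epsilon>" "\<And>x y. dist x y < \<epsilon> \<Longrightarrow> c x = c y"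
proof -
  define c :: "'a \<Rightarrow> 'a" where "c x = (SOME y. y \<in> ball x \<epsilon>)" for x
  have near: "dist x (c x) < \<epsilon>" for x
    using someI[of "\<lambda>y. y \<in> ball x \<epsilon>" x] eps by (simp add: c_def)
  have const: "c x = c y" if "dist x y < \<epsilon>" for x y
  proof -
    have "dist x z < \<epsilon> \<longleftrightarrow> dist y z < \<epsilon>" for z
      using that ultrametric[of x z y] ultrametric[of y z x] dist_commute[of x y] by linarith
    then have "ball x \<epsilon> = ball y \<epsilon>" by auto
    then show ?thesis by (simp add: c_def)
  qed
  obtain S where S: "finite S" "(UNIV :: 'a set) \<subseteq> (\<Union>x\<in>S. ball x \<epsilon>)"
    using comp eps unfolding compact_eq_totally_bounded by blast
  have "range c \<subseteq> c ` S"
  proof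
    fix y assume "y \<in> range c"
    then obtain x where x: "y = c x" by blast
    obtain s where "s \<in> S" "dist s x < \<epsilon>" using S(2) by (force simp: subset_iff)
    then show "y \<in> c ` S" using const[of s x] x by (metis imageI)
  qed
  then have "finite (range c)" using S(1) finite_surj by blast
  then show thesis using that near const by blast
qed

text \<open>The indicator of the cell of \<open>s\<close>, for a retraction \<open>c\<close> onto the centres of the cells.\<close>

definition cell :: "('a \<Rightarrow> 'a) \<Rightarrow> 'a \<Rightarrow> 'a \<Rightarrow> 'k::nonarch_valued_field" where
  "cell c s x = (if c x = s then 1 else 0)"

lemma cell_BL:
  fixes c :: "'a::metric_space \<Rightarrow> 'a"
  assumes "\<epsilon> > 0" "\<And>x y. dist x y < \<epsilon> \<Longrightarrow> c x = c y"
  shows "(cell c s :: 'a \<Rightarrow> 'k::nonarch_valued_field) \<in> BL"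
  using assms(1)
proof (rule BL_if_locally_constant)
  show "cell c s x = (cell c s y :: 'k)" if "dist x y < \<epsilon>" for x y
    using assms(2)[OF that] by (simp add: cell_def)
  show "absval (cell c s x :: 'k) \<le> 1" for x by (auto simp: cell_def)
qed

text \<open>
  Write \<open>f = (f - f \<circ> c) + f \<circ> c\<close>. The first summand is at most \<open>\<delta>\<close> in absolute value, which
  the bounds of the measures control, and the second is the combination of cell indicators with
  coefficients \<open>f s\<close>.
\<close>

lemma measure_diff_le_cells:
  fixes f :: "'a::metric_space \<Rightarrow> 'k::nonarch_valued_field"
  assumes mu: "\<mu> \<in> MEA" "measure_bound \<mu> M" and nu: "\<nu> \<in> MEA" "measure_bound \<nu> N"
    and f: "f \<in> Cont" and fin: "finite (range c)"
    and eps: "\<epsilon> > 0" and const: "\<And>x y. dist x y < \<epsilon> \<Longrightarrow> c x = c y"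
    and close: "\<And>x. absval (f x - f (c x)) \<le> \<delta>"
  shows "absval (\<mu> f - \<nu> f) \<le>
    (M + N) * \<delta> + (\<Sum>s\<in>range c. absval (f s) * absval (\<mu> (cell c s) - \<nu> (cell c s)))"
proof -
  define g :: "'a \<Rightarrow> 'k" where "g x = (\<Sum>s\<in>range c. f s * cell c s x)" for x
  define h where "h x = f x + (- 1) * g x" for x
  have g_eq: "g x = f (c x)" for x
  proof -
    have "g x = (\<Sum>s\<in>range c. if c x = s then f s else 0)"
      unfolding g_def by (intro sum.cong) (auto simp: cell_def)
    then show ?thesis using fin by (simp add: sum.delta')
  qed
  have cellC: "(cell c s :: 'a \<Rightarrow> 'k) \<in> Cont" for s
    using cell_BL[of \<epsilon> c s, OF eps const] BL_subset_Cont by blast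
  have g: "g \<in> Cont" "\<rho> g = (\<Sum>s\<in>range c. f s * \<rho> (cell c s))" if "\<rho> \<in> MEA" for \<rho>
    using MEA_linear_combination[OF that fin cellC, of f] unfolding g_def by auto
  have gC: "g \<in> Cont" using g(1)[OF mu(1)] .
  have hC: "h \<in> Cont" unfolding h_def using Cont_add[OF f Cont_scale[OF gC]] .
  have "0 \<le> \<delta>" using close absval_nonneg order_trans by blast
  have h_le: "absval (h x) \<le> \<delta>" for x using close[of x] by (simp add: h_def g_eq)
  have split: "\<rho> f = \<rho> h + \<rho> g" if "\<rho> \<in> MEA" for \<rho>
    using MEA_add[OF that hC gC] by (simp add: h_def)
  have muh: "absval (\<mu> h) \<le> M * \<delta>" and nuh: "absval (\<nu> h) \<le> N * \<delta>"
    using measure_bound_absval_le[OF mu(2) hC \<open>0 \<le> \<delta>\<close> h_le]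
      measure_bound_absval_le[OF nu(2) hC \<open>0 \<le> \<delta>\<close> h_le] by auto
  have "\<mu> g - \<nu> g = (\<Sum>s\<in>range c. f s * (\<mu> (cell c s) - \<nu> (cell c s)))"
    using g(2)[OF mu(1)] g(2)[OF nu(1)] by (simp add: sum_subtractf right_diff_distrib)
  then have gle: "absval (\<mu> g - \<nu> g) \<le>
      (\<Sum>s\<in>range c. absval (f s) * absval (\<mu> (cell c s) - \<nu> (cell c s)))"
    using absval_sum_le[of "\<lambda>s. f s * (\<mu> (cell c s) - \<nu> (cell c s))" "range c"]
    by (simp add: absval_mult)
  have "\<mu> f - \<nu> f = (\<mu> h - \<nu> h) + (\<mu> g - \<nu> g)"
    using split[OF mu(1)] split[OF nu(1)] by simp
  then have "absval (\<mu> f - \<nu> f) \<le> absval (\<mu> h) + absval (\<nu> h) + absval (\<mu> g - \<nu> g)"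
    using absval_add_le[of "\<mu> h - \<nu> h" "\<mu> g - \<nu> g"] absval_diff_le[of "\<mu> h" "\<nu> h"] by simp
  then show ?thesis using muh nuh gle by (simp add: distrib_right)
qed

section \<open>Convergence of measures\<close>

lemma tendsto_zero_ennreal_iff:
  "(f \<longlongrightarrow> (0::ennreal)) F \<longleftrightarrow> (\<forall>e>0. eventually (\<lambda>n. f n \<le> ennreal e) F)"
proof
  assume lim: "(f \<longlongrightarrow> 0) F"
  show "\<forall>e>0. eventually (\<lambda>n. f n \<le> ennreal e) F"
  proof (intro allI impI)
    fix e :: real assume "e > 0"
    then have "eventually (\<lambda>n. f n < ennreal e) F" using order_tendstoD(2)[OF lim] by simp
    then show "eventually (\<lambda>n. f n \<le> ennreal e) F" by eventually_elim (rule less_imp_le)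
  qed
next
  assume ev: "\<forall>e>0. eventually (\<lambda>n. f n \<le> ennreal e) F"
  show "(f \<longlongrightarrow> 0) F"
  proof (rule order_tendstoI)
    fix a :: ennreal assume "0 < a"
    then obtain b where "0 < b" "b < a" using dense by blast
    then obtain e where "b = ennreal e" "e > 0" by (cases b) auto
    then show "eventually (\<lambda>n. f n < a) F"
      using ev \<open>b < a\<close> by (auto elim!: eventually_mono)
  qed simp
qed

text \<open>
  The estimate \<open>measure_diff_le_cells\<close> for a uniformly bounded sequence that converges on the
  indicators, made uniform over a class \<open>A\<close> of functions. The class enters through a common
  modulus of continuity and a common bound only.
\<close>

lemma uniform_convergence_on_equicontinuous:
  fixes \<mu> :: "('a::metric_space \<Rightarrow> 'k::nonarch_valued_field) \<Rightarrow> 'k"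
  assumes ultrametric: "\<And>x y z :: 'a. dist x z \<le> max (dist x y) (dist y z)"
    and comp: "compact (UNIV :: 'a set)"
    and mu: "\<mu> \<in> MEA" "measure_bound \<mu> M"
    and mus: "\<And>n. n \<ge> 1 \<Longrightarrow> \<mu>s n \<in> MEA" "\<And>n. n \<ge> 1 \<Longrightarrow> measure_bound (\<mu>s n) N"
    and conv: "\<And>f. f \<in> BL \<Longrightarrow> (\<lambda>n. \<mu>s n f) \<longlonglongrightarrow> \<mu> f"
    and A: "A \<subseteq> Cont" and bd: "\<And>f x. f \<in> A \<Longrightarrow> absval (f x) \<le> B"
    and equicont: "\<And>\<delta>. \<delta> > 0 \<Longrightarrow>
      \<exists>\<epsilon>>0. \<forall>f\<in>A. \<forall>x y. dist x y < \<epsilon> \<longrightarrow> absval (f x - f y) \<le> \<delta>"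
    and e: "e > 0"
  shows "eventually (\<lambda>n. \<forall>f\<in>A. absval (\<mu>s n f - \<mu> f) \<le> e) sequentially"
proof -
  have MN: "0 \<le> M" "0 \<le> N"
    using mu(2) mus(2)[of 1] by (auto simp: measure_bound_def)
  define \<delta> where "\<delta> = e / (2 * (N + M + 1))"
  have "\<delta> > 0" using e MN by (simp add: \<delta>_def)
  have "(N + M) * \<delta> \<le> (N + M + 1) * \<delta>" using \<open>\<delta> > 0\<close> by simp
  also have "\<dots> = e / 2" using MN by (simp add: \<delta>_def field_simps)
  finally have small: "(N + M) * \<delta> \<le> e / 2" .
  obtain \<epsilon> where eps: "\<epsilon> > 0"
    and close: "\<And>f x y. f \<in> A \<Longrightarrow> dist x y < \<epsilon> \<Longrightarrow> absval (f x - f y) \<le> \<delta>"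
    using equicont[OF \<open>\<delta> > 0\<close>] by blast
  obtain c :: "'a \<Rightarrow> 'a" where fin: "finite (range c)" and near: "\<And>x. dist x (c x) < \<epsilon>"
    and const: "\<And>x y. dist x y < \<epsilon> \<Longrightarrow> c x = c y"
    using finite_ultrametric_retraction[OF ultrametric comp eps] by blast
  have "(\<lambda>n. \<Sum>s\<in>range c. B * absval (\<mu>s n (cell c s) - \<mu> (cell c s)))
      \<longlonglongrightarrow> (\<Sum>s\<in>range c. B * 0)"
    using conv[OF cell_BL[of \<epsilon> c, OF eps const]]
    by (intro tendsto_sum tendsto_mult tendsto_const) (simp add: tendsto_iff_absval)
  then have "eventually (\<lambda>n. (\<Sum>s\<in>range c. B * absval (\<mu>s n (cell c s) - \<mu> (cell c s))) < e / 2)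
      sequentially"
    using e by (intro order_tendstoD(2)[where y = "0 :: real"]) auto
  then show ?thesis
    using eventually_ge_at_top[of 1]
  proof eventually_elim
    case (elim n)
    show ?case
    proof
      fix f assume f: "f \<in> A"
      have "absval (\<mu>s n f - \<mu> f) \<le> (N + M) * \<delta> +
          (\<Sum>s\<in>range c. absval (f s) * absval (\<mu>s n (cell c s) - \<mu> (cell c s)))"
        using f A near close
        by (intro measure_diff_le_cells[OF mus(1) mus(2) mu(1) mu(2) _ fin eps const])
          (use elim in auto)
      also have "\<dots> \<le> e / 2 +
          (\<Sum>s\<in>range c. B * absval (\<mu>s n (cell c s) - \<mu> (cell c s)))"
        by (intro add_mono small sum_mono mult_right_mono bd[OF f]) auto
      also have "\<dots> \<le> e" using elim by simp
      finally show "absval (\<mu>s n f - \<mu> f) \<le> e" .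
    qed
  qed
qed

text \<open>A single continuous function is an equicontinuous class by the Heine--Cantor theorem.\<close>

lemma mea_converges_if_converges_on_BL:
  fixes \<mu> :: "('a::metric_space \<Rightarrow> 'k::nonarch_valued_field) \<Rightarrow> 'k"
  assumes ultrametric: "\<And>x y z :: 'a. dist x z \<le> max (dist x y) (dist y z)"
    and comp: "compact (UNIV :: 'a set)"
    and mu: "\<mu> \<in> MEA" "measure_bound \<mu> M"
    and mus: "\<And>n. n \<ge> 1 \<Longrightarrow> \<mu>s n \<in> MEA" "\<And>n. n \<ge> 1 \<Longrightarrow> measure_bound (\<mu>s n) N"
    and conv: "\<And>f. f \<in> BL \<Longrightarrow> (\<lambda>n. \<mu>s n f) \<longlonglongrightarrow> \<mu> f"
  shows "mea_converges \<mu>s \<mu>"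
  unfolding mea_converges_def
proof
  fix f :: "'a \<Rightarrow> 'k" assume f: "f \<in> Cont"
  obtain r where r: "0 \<le> r" "sup_norm f = ennreal r" using sup_norm_finite[OF comp f] by blast
  have bd: "absval (f x) \<le> r" for x
  proof -
    have "ennreal (absval (f x)) \<le> sup_norm f" unfolding sup_norm_def by (rule SUP_upper) simp
    then show ?thesis using r by simp
  qed
  have unif: "uniformly_continuous_on UNIV f"
    using comp f compact_uniformly_continuous unfolding Cont_def by blast
  have equi: "\<exists>\<epsilon>>0. \<forall>g\<in>{f}. \<forall>x y. dist x y < \<epsilon> \<longrightarrow> absval (g x - g y) \<le> \<delta>"
    if "\<delta> > 0" for \<delta>
    using unif that unfolding uniformly_continuous_on_def
    by (simp add: dist_absval[where 'a = 'k]) (metis less_imp_le)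
  have ev: "eventually (\<lambda>n. absval (\<mu>s n f - \<mu> f) \<le> e) sequentially" if "e > 0" for e
    using uniform_convergence_on_equicontinuous[OF ultrametric comp mu mus conv,
        where A = "{f}" and B = r, OF _ _ _ _ _ equi that] f bd by auto
  show "(\<lambda>n. \<mu>s n f) \<longlonglongrightarrow> \<mu> f"
  proof (rule tendstoI)
    fix e :: real assume "e > 0"
    then show "eventually (\<lambda>n. dist (\<mu>s n f) (\<mu> f) < e) sequentially"
      using ev[of "e / 2"] by (auto simp: dist_absval elim: eventually_mono)
  qed
qed

text \<open>The unit ball of \<^const>\<open>BL\<close> is equicontinuous, with modulus of continuity \<open>\<epsilon> = \<delta>\<close>.\<close>

lemma BL_dist_tendsto_0_if_converges_on_BL:
  fixes \<mu> :: "('a::metric_space \<Rightarrow> 'k::nonarch_valued_field) \<Rightarrow> 'k"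
  assumes ultrametric: "\<And>x y z :: 'a. dist x z \<le> max (dist x y) (dist y z)"
    and comp: "compact (UNIV :: 'a set)"
    and mu: "\<mu> \<in> MEA" "measure_bound \<mu> M"
    and mus: "\<And>n. n \<ge> 1 \<Longrightarrow> \<mu>s n \<in> MEA" "\<And>n. n \<ge> 1 \<Longrightarrow> measure_bound (\<mu>s n) N"
    and conv: "\<And>f. f \<in> BL \<Longrightarrow> (\<lambda>n. \<mu>s n f) \<longlonglongrightarrow> \<mu> f"
  shows "(\<lambda>n. BL_dist (\<mu>s n) \<mu>) \<longlonglongrightarrow> 0"
  unfolding tendsto_zero_ennreal_iff
proof (intro allI impI)
  fix e :: real assume e: "e > 0"
  define A where "A = {f :: 'a \<Rightarrow> 'k. f \<in> Cont \<and> BL_norm f \<le> 1}"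
  have AC: "A \<subseteq> Cont" by (auto simp: A_def)
  have A1: "absval (f x) \<le> 1" and A2: "absval (f x - f y) \<le> dist x y" if "f \<in> A" for f x y
    using that BL_norm_le_ennreal_iff[of 1 f] by (auto simp: A_def)
  have equi: "\<exists>\<epsilon>>0. \<forall>f\<in>A. \<forall>x y. dist x y < \<epsilon> \<longrightarrow> absval (f x - f y) \<le> \<delta>"
    if "\<delta> > 0" for \<delta>
    using that by (intro exI[of _ \<delta>]) (auto intro: order_trans[OF A2] less_imp_le)
  have "eventually (\<lambda>n. \<forall>f\<in>A. absval (\<mu>s n f - \<mu> f) \<le> e) sequentially"
    by (rule uniform_convergence_on_equicontinuous[OF ultrametric comp mu mus conv AC _ equi e])
      (use A1 in blast)+
  then show "eventually (\<lambda>n. BL_dist (\<mu>s n) \<mu> \<le> ennreal e) sequentially"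
    by eventually_elim (auto simp: BL_dist_def A_def SUP_le_iff intro: ennreal_leI)
qed

lemma absval_diff_le_BL_dist:
  fixes f :: "'a::metric_space \<Rightarrow> 'k::nonarch_valued_field"
  assumes mu: "\<mu> \<in> MEA" and nu: "\<nu> \<in> MEA" and f: "f \<in> Cont"
    and unit: "BL_norm (\<lambda>x. a * f x) \<le> 1"
  shows "ennreal (absval a * absval (\<mu> f - \<nu> f)) \<le> BL_dist \<mu> \<nu>"
proof -
  let ?g = "\<lambda>x. a * f x"
  have "ennreal (absval (\<mu> ?g - \<nu> ?g)) \<le> BL_dist \<mu> \<nu>"
    unfolding BL_dist_def using Cont_scale[OF f] unit by (intro SUP_upper) simp
  moreover have "\<mu> ?g - \<nu> ?g = a * (\<mu> f - \<nu> f)"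
    using MEA_scale[OF mu f] MEA_scale[OF nu f] by (simp add: right_diff_distrib)
  ultimately show ?thesis by (simp add: absval_mult)
qed

text \<open>
  The absolute value of \<open>K\<close> may be discrete, so a scalar \<open>a\<close> with \<open>|a|\<close> equal to the inverse
  of the norm of \<open>f\<close> need not exist. A nonzero scalar below that inverse suffices.
\<close>

lemma converges_on_BL_if_BL_dist_tendsto_0:
  fixes \<mu> :: "('a::metric_space \<Rightarrow> 'k::nonarch_valued_field) \<Rightarrow> 'k"
  assumes small: "\<And>r. r > 0 \<Longrightarrow> \<exists>a::'k. a \<noteq> 0 \<and> absval a \<le> r"
    and mu: "\<mu> \<in> MEA" and mus: "\<And>n. n \<ge> 1 \<Longrightarrow> \<mu>s n \<in> MEA"
    and lim: "(\<lambda>n. BL_dist (\<mu>s n) \<mu>) \<longlonglongrightarrow> 0" and f: "f \<in> BL"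
  shows "(\<lambda>n. \<mu>s n f) \<longlonglongrightarrow> \<mu> f"
proof (rule tendstoI)
  fix e :: real assume e: "e > 0"
  obtain r where r: "r \<ge> 0" "\<And>x. absval (f x) \<le> r" "\<And>x y. absval (f x - f y) \<le> r * dist x y"
    using f by (auto simp: BL_iff BL_norm_le_ennreal_iff)
  \<comment> \<open>Adding \<open>1\<close> keeps the bound positive when \<open>r = 0\<close>.\<close>
  obtain a :: 'k where a: "a \<noteq> 0" "absval a \<le> 1 / (r + 1)"
    using small[of "1 / (r + 1)"] r(1) by auto
  have "absval a > 0" using a(1) absval_nonneg[of a] by (simp add: less_le)
  have ar: "absval a * r \<le> 1"
  proof -
    have "absval a * r \<le> 1 / (r + 1) * r" using a(2) r(1) by (rule mult_right_mono)
    also have "\<dots> \<le> 1" using r(1) by (simp add: field_simps)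
    finally show ?thesis .
  qed
  have "absval (a * f x) \<le> 1" for x
    using mult_left_mono[OF r(2)[of x] absval_nonneg[of a]] ar by (simp add: absval_mult)
  moreover have "absval (a * f x - a * f y) \<le> 1 * dist x y" for x y
  proof -
    have "absval (a * f x - a * f y) = absval a * absval (f x - f y)"
      by (metis absval_mult right_diff_distrib)
    also have "\<dots> \<le> absval a * r * dist x y"
      using mult_left_mono[OF r(3)[of x y] absval_nonneg[of a]] by (simp add: mult.assoc)
    also have "\<dots> \<le> 1 * dist x y" using ar by (intro mult_right_mono) auto
    finally show ?thesis .
  qed
  ultimately have unit: "BL_norm (\<lambda>x. a * f x) \<le> 1"
    using BL_norm_le_ennreal_iff[of 1 "\<lambda>x. a * f x"] by simp
  have "eventually (\<lambda>n. BL_dist (\<mu>s n) \<mu> < ennreal (absval a * e)) sequentially"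
    using order_tendstoD(2)[OF lim] \<open>absval a > 0\<close> e by simp
  then show "eventually (\<lambda>n. dist (\<mu>s n f) (\<mu> f) < e) sequentially"
    using eventually_ge_at_top[of 1]
  proof eventually_elim
    case (elim n)
    have "ennreal (absval a * absval (\<mu>s n f - \<mu> f)) < ennreal (absval a * e)"
      using absval_diff_le_BL_dist[OF mus[OF elim(2)] mu _ unit] f BL_subset_Cont elim(1)
      by (blast intro: le_less_trans)
    then show ?case
      using \<open>absval a > 0\<close> by (simp add: ennreal_less_iff dist_absval)
  qed
qed

theorem theorem5p3:
  fixes \<mu> :: "('a::metric_space \<Rightarrow> 'k::{nonarch_valued_field, complete_space}) \<Rightarrow> 'k"
    and \<mu>s :: "nat \<Rightarrow> ('a \<Rightarrow> 'k) \<Rightarrow> 'k"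
  assumes ultrametric: "\<And>x y z :: 'a. dist x z \<le> max (dist x y) (dist y z)"
    and compact: "compact (UNIV :: 'a set)"
    and balls_X: "\<And>B :: 'a set. is_ball B \<Longrightarrow> \<exists>x\<in>B. \<exists>y\<in>B. x \<noteq> y"
    and balls_K: "\<And>B :: 'k set. is_ball B \<Longrightarrow> \<exists>x\<in>B. \<exists>y\<in>B. x \<noteq> y"
    and mu: "\<mu> \<in> MEA"
    and mus: "\<And>n. n \<ge> 1 \<Longrightarrow> \<mu>s n \<in> MEA"
    and bounded: "\<exists>c>0. \<forall>n\<ge>1. mea_norm (\<mu>s n) \<le> c"
  shows "(mea_converges \<mu>s \<mu> \<longleftrightarrow> (\<forall>f\<in>BL. (\<lambda>n. \<mu>s n f) \<longlonglongrightarrow> \<mu> f)) \<and>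
         ((\<forall>f\<in>BL. (\<lambda>n. \<mu>s n f) \<longlonglongrightarrow> \<mu> f) \<longleftrightarrow> (\<lambda>n. BL_dist (\<mu>s n) \<mu>) \<longlonglongrightarrow> 0)"
proof -
  have bound_mu: "measure_bound \<mu> (mea_norm \<mu>)"
    using measure_bound_mea_norm[OF compact mu] .
  obtain N where N: "\<And>n. n \<ge> 1 \<Longrightarrow> mea_norm (\<mu>s n) \<le> N" using bounded by blast
  have bound_mus: "measure_bound (\<mu>s n) N" if "n \<ge> 1" for n
    using measure_bound_mono[OF measure_bound_mea_norm[OF compact mus[OF that]] N[OF that]] .
  have small: "\<exists>a::'k. a \<noteq> 0 \<and> absval a \<le> r" if "r > 0" for r
  proof -
    have "is_ball (cball (0::'k) r)" using that by (auto simp: is_ball_def)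
    then obtain x y where "x \<in> cball (0::'k) r" "y \<in> cball (0::'k) r" "x \<noteq> y"
      using balls_K by blast
    then show ?thesis
      by (cases "x = 0") (auto simp: absval_eq_dist dist_commute)
  qed
  have 1: "\<forall>f\<in>BL. (\<lambda>n. \<mu>s n f) \<longlonglongrightarrow> \<mu> f" if "mea_converges \<mu>s \<mu>"
    using that BL_subset_Cont unfolding mea_converges_def by blast
  have 2: "mea_converges \<mu>s \<mu>" if "\<forall>f\<in>BL. (\<lambda>n. \<mu>s n f) \<longlonglongrightarrow> \<mu> f"
    using mea_converges_if_converges_on_BL[OF ultrametric compact mu bound_mu mus bound_mus] that
    by simp
  have 3: "(\<lambda>n. BL_dist (\<mu>s n) \<mu>) \<longlonglongrightarrow> 0"
    if "\<forall>f\<in>BL. (\<lambda>n. \<mu>s n f) \<longlonglongrightarrow> \<mu> f"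
    using BL_dist_tendsto_0_if_converges_on_BL[OF ultrametric compact mu bound_mu mus bound_mus] that
    by simp
  have 4: "\<forall>f\<in>BL. (\<lambda>n. \<mu>s n f) \<longlonglongrightarrow> \<mu> f"
    if "(\<lambda>n. BL_dist (\<mu>s n) \<mu>) \<longlonglongrightarrow> 0"
    using converges_on_BL_if_BL_dist_tendsto_0[OF small mu mus that] by simp
  show ?thesis using 1 2 3 4 by (intro conjI iffI)
qed

end
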